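(* (Expander Mixing Lemma for Weighted $(r+1)$-Partite Graphs) Let $r\ge1$ and let $(X,w)$ be a weighted $(r+1)$-partite simplicial complex that is an $(r+1)$-partite $[-\lambda,\lambda]$-expander. Let $A,B\subseteq X(0)$ and put $\alpha=w(A)$, $\beta=w(B)$, $\alpha_i=w(A\cap X_{\{i\}})$ and $\beta_i=w(B\cap X_{\{i\}})$ ($i\in\{0,\dots,r\}$). Then: (i) If there are $T,S\subseteq\{0,\dots,r\}$ such that $A\subseteq\bigcup_{i\in T}X_{\{i\}}$, $B\subseteq\bigcup_{j\in S}X_{\{j\}}$ and $S\cap T=\emptyset$, then $$\left|\tfrac12 w(E(A,B))-\tfrac{r+1}{r}\alpha\beta\right|\leq\lambda(r+1)\sqrt{\alpha\beta\left(\tfrac{|T|}{r+1}-\alpha\right)\left(\tfrac{|S|}{r+1}-\beta\right)}.$$ (ii) In general, $$\left|\tfrac12 w(E_{\mathrm{ord}}(A,B))-\tfrac{r+1}{r}\Big[\alpha\beta-\sum_{i=0}^r\alpha_i\beta_i\Big]\right|\leq\lambda r\sqrt{\alpha\beta(1-\alpha)(1-\beta)}.$$ In particular, $$\tfrac12 w(E_{\mathrm{ord}}(A,B))\leq\tfrac{r+1}{r}\Big[\alpha\beta-\sum_{i=0}^r\alpha_i\beta_i\Big]+\lambda r\sqrt{\alpha\beta(1-\alpha)(1-\beta)}\leq\tfrac{r+1}{r}\alpha\beta+\lambda r\sqrt{\alpha\beta(1-\alpha)(1-\beta)}.$$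
   Context: Simplicial complexes are finite, nonempty families of finite sets closed under taking subsets (so $\emptyset\in X$); $X(i)$ is the set of faces of dimension $i$ (cardinality $i+1$). A weighted $(r+1)$-partite simplicial complex consists of a simplicial complex $X$ that is pure of dimension $r$ (every face is contained in an $r$-face), a partition $V_0,\dots,V_r$ of its vertex set into nonempty parts such that every face has at most one vertex in each $V_i$, and a weight function $w:X\to[0,\infty)$ satisfying $\sum_{y\in X(r)}w(y)=1$, $w(x)=\binom{r+1}{\dim x+1}^{-1}\sum_{y\in X(r),\,y\supseteq x}w(y)$ for all $x\in X$ with $\dim x<r$, and $w(v)>0$ for all $v\in X(0)$. For a set $A$ of faces, $w(A)=\sum_{a\in A}w(a)$. $X_{\{i\}}$ is the set of $0$-faces whose vertex is in $V_i$. $E(A,B)$ is the set of (unordered) edges with one vertex in $A$ and the other in $B$; $E_{\mathrm{ord}}(A,B)$ is the set of ordered pairs $(u,v)$ with $u\in A$, $v\in B$ and $\{u,v\}$ an edge; the weight of an ordered edge is that of the underlying edge, and weights of sets are sums of weights of members. Partite spectral expansion: on functions $f:X(0)\to\mathbb{R}$ with inner product $\langle f,g\rangle=\sum_{v}w(v)f(v)g(v)$, the weighted adjacency operator is $(\mathcal{A}f)(v)=\sum_{e\in X(1),\,e\supseteq v}\frac{w(e)}{2w(v)}f(e-v)$, where $e-v$ is the other vertex of $e$. It is self-adjoint, and preserves the span $L$ of the indicator functions $1_{X_{\{0\}}},\dots,1_{X_{\{r\}}}$ and hence $C^0_\diamond(X,\mathbb{R}):=L^\perp$. For real $\mu\le\lambda$,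 $(X,w)$ is an $(r+1)$-partite $[\mu,\lambda]$-expander if all eigenvalues of $\mathcal{A}$ on $C^0_\diamond(X,\mathbb{R})$ lie in $[\mu,\lambda]$ (so $\lambda\ge0$ when $\mu=-\lambda$). *)

theory Defs
  imports Complex_Main "HOL-Library.Disjoint_Sets" "HOL-Library.Indicator_Function"
begin

locale abstract_simplicial_complex =
  fixes X :: "'a set set"
  assumes finite_complex: "finite X"
    and nonempty_complex: "X \<noteq> {}"
    and finite_face: "\<And>x. x \<in> X \<Longrightarrow> finite x"
    and subset_closed: "\<And>x y. x \<in> X \<Longrightarrow> y \<subseteq> x \<Longrightarrow> y \<in> X"

text \<open>Dimensions are integers because the empty face has dimension -1.\<close>

definition face_dim :: "'a set \<Rightarrow> int" where
  "face_dim x = int (card x) - 1"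

definition faces_of_dim :: "'a set set \<Rightarrow> int \<Rightarrow> 'a set set" where
  "faces_of_dim X i = {x \<in> X. face_dim x = i}"

text \<open>
  Only the values of \<open>V\<close> on \<open>{0..r}\<close> and of \<open>w\<close> on \<open>X\<close> are relevant.
  In the binomial coefficient, \<open>card x\<close> is the dimension of \<open>x\<close> plus one.
\<close>

locale weighted_partite_complex = abstract_simplicial_complex X
  for X :: "'a set set" +
  fixes r :: nat
    and V :: "nat \<Rightarrow> 'a set"
    and w :: "'a set \<Rightarrow> real"
  assumes pure: "\<And>x. x \<in> X \<Longrightarrow> \<exists>y \<in> faces_of_dim X (int r). x \<subseteq> y"
    and parts_nonempty: "\<And>i. i \<in> {0..r} \<Longrightarrow> V i \<noteq> {}"
    and parts_disjoint: "disjoint_family_on V {0..r}"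
    and parts_cover: "(\<Union>i\<in>{0..r}. V i) = \<Union>X"
    and partite: "\<And>x i. x \<in> X \<Longrightarrow> i \<in> {0..r} \<Longrightarrow> card (x \<inter> V i) \<le> 1"
    and weight_nonneg: "\<And>x. x \<in> X \<Longrightarrow> 0 \<le> w x"
    and weight_top: "(\<Sum>y\<in>faces_of_dim X (int r). w y) = 1"
    and weight_face: "\<And>x. x \<in> X \<Longrightarrow> face_dim x < int r \<Longrightarrow>
          w x = inverse (real ((r + 1) choose card x)) *
                (\<Sum>y\<in>{y \<in> faces_of_dim X (int r). x \<subseteq> y}. w y)"
    and weight_vertex_pos: "\<And>v. v \<in> faces_of_dim X 0 \<Longrightarrow> 0 < w v"

text \<open>
  Following the convention that \<open>X(0)\<close> consists of faces, the elements of
  \<open>X(0)\<close> are singletons, not points. Thus, for an edge \<open>e\<close> and a 0-face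
  \<open>v \<subseteq> e\<close>, the other 0-face of \<open>e\<close> is the set difference \<open>e - v\<close>, and the edge
  spanned by two distinct 0-faces \<open>u\<close> and \<open>v\<close> is \<open>u \<union> v\<close>.
\<close>

definition part_faces :: "'a set set \<Rightarrow> (nat \<Rightarrow> 'a set) \<Rightarrow> nat \<Rightarrow> 'a set set" where
  "part_faces X V i = {v \<in> faces_of_dim X 0. v \<subseteq> V i}"

definition set_weight :: "('a set \<Rightarrow> real) \<Rightarrow> 'a set set \<Rightarrow> real" where
  "set_weight w F = (\<Sum>x\<in>F. w x)"

definition edges_between :: "'a set set \<Rightarrow> 'a set set \<Rightarrow> 'a set set \<Rightarrow> 'a set set" where
  "edges_between X A B = {e \<in> faces_of_dim X 1. \<exists>u\<in>A. \<exists>v\<in>B. e = u \<union> v}"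

definition ordered_edges_between ::
    "'a set set \<Rightarrow> 'a set set \<Rightarrow> 'a set set \<Rightarrow> ('a set \<times> 'a set) set" where
  "ordered_edges_between X A B = {(u, v). u \<in> A \<and> v \<in> B \<and> u \<union> v \<in> faces_of_dim X 1}"

definition ordered_set_weight :: "('a set \<Rightarrow> real) \<Rightarrow> ('a set \<times> 'a set) set \<Rightarrow> real" where
  "ordered_set_weight w F = (\<Sum>(u, v)\<in>F. w (u \<union> v))"

text \<open>
  Functions from \<open>X(0)\<close> to the reals are represented by total functions that
  vanish outside \<open>X(0)\<close>.
\<close>

definition vertex_functions :: "'a set set \<Rightarrow> ('a set \<Rightarrow> real) set" where
  "vertex_functions X = {f. \<forall>v. v \<notin> faces_of_dim X 0 \<longrightarrow> f v = 0}"

definition weighted_inner ::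
    "'a set set \<Rightarrow> ('a set \<Rightarrow> real) \<Rightarrow> ('a set \<Rightarrow> real) \<Rightarrow> ('a set \<Rightarrow> real) \<Rightarrow> real" where
  "weighted_inner X w f g = (\<Sum>v\<in>faces_of_dim X 0. w v * f v * g v)"

definition weighted_adjacency ::
    "'a set set \<Rightarrow> ('a set \<Rightarrow> real) \<Rightarrow> ('a set \<Rightarrow> real) \<Rightarrow> ('a set \<Rightarrow> real)" where
  "weighted_adjacency X w f =
     (\<lambda>v. if v \<in> faces_of_dim X 0
          then \<Sum>e\<in>{e \<in> faces_of_dim X 1. v \<subseteq> e}. w e / (2 * w v) * f (e - v)
          else 0)"

definition part_indicator_span ::
    "nat \<Rightarrow> 'a set set \<Rightarrow> (nat \<Rightarrow> 'a set) \<Rightarrow> ('a set \<Rightarrow> real) set" where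
  "part_indicator_span r X V =
     {g. \<exists>c. g = (\<lambda>v. \<Sum>i=0..r. c i * indicator (part_faces X V i) v)}"

text \<open>The space \<open>C\<^sup>0\<^sub>\<diamond>(X, \<real>)\<close>.\<close>

definition diamond_space ::
    "nat \<Rightarrow> 'a set set \<Rightarrow> (nat \<Rightarrow> 'a set) \<Rightarrow> ('a set \<Rightarrow> real) \<Rightarrow> ('a set \<Rightarrow> real) set" where
  "diamond_space r X V w =
     {f \<in> vertex_functions X. \<forall>g \<in> part_indicator_span r X V. weighted_inner X w f g = 0}"

definition eigenvalue_on ::
    "(('b \<Rightarrow> real) \<Rightarrow> ('b \<Rightarrow> real)) \<Rightarrow> ('b \<Rightarrow> real) set \<Rightarrow> real \<Rightarrow> bool" where
  "eigenvalue_on T U \<kappa> \<longleftrightarrow> (\<exists>f\<in>U. f \<noteq> (\<lambda>_. 0) \<and> T f = (\<lambda>v. \<kappa> * f v))"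

text \<open>
  The condition \<open>\<mu> \<le> \<lambda>\<close> is part of the notion; it does not follow from the
  eigenvalue condition when \<open>C\<^sup>0\<^sub>\<diamond>(X, \<real>)\<close> is zero.
\<close>

definition partite_expander ::
    "nat \<Rightarrow> 'a set set \<Rightarrow> (nat \<Rightarrow> 'a set) \<Rightarrow> ('a set \<Rightarrow> real) \<Rightarrow> real \<Rightarrow> real \<Rightarrow> bool" where
  "partite_expander r X V w \<mu> lam \<longleftrightarrow>
     \<mu> \<le> lam \<and>
     (\<forall>\<kappa>. eigenvalue_on (weighted_adjacency X w) (diamond_space r X V w) \<kappa> \<longrightarrow> \<kappa> \<in> {\<mu>..lam})"

end

theory Submission
  imports Defs "HOL-Analysis.Function_Topology" "HOL-Analysis.Convex"
begin

text \<open>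
  Every top-dimensional face meets each part in exactly one vertex, so double counting gives each
  part weight \<open>1 / (r + 1)\<close> and shows that the adjacency operator sends the indicator of the \<open>j\<close>-th
  part to \<open>1 / r\<close> times the indicator of the other parts. The value
  \<open>w(E\<^sub>o\<^sub>r\<^sub>d(A, B)) / 2\<close> is the adjacency form at the indicators of \<open>A\<close> and \<open>B\<close>. Projecting both
  indicators to the diamond space splits off the main term, and the rest is at most
  \<open>\<lambda> \<parallel>f\<parallel> \<parallel>g\<parallel>\<close> for the projections \<open>f\<close> and \<open>g\<close>, where
  \<open>\<parallel>f\<parallel>\<^sup>2 = \<alpha> - (r + 1) \<Sum>\<^sub>i \<alpha>\<^sub>i\<^sup>2\<close> is bounded by Cauchy-Schwarz over the parts that meet \<open>A\<close>.

  The passage from eigenvalues to the operator norm is variational: if \<open>f\<close> maximises \<open>\<parallel>T f\<parallel>\<close> on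
  the unit sphere of an invariant space of the self-adjoint operator \<open>T\<close>, with maximum \<open>M\<close>, then
  \<open>T\<^sup>2 f = M\<^sup>2 f\<close>, so either \<open>T f + M f\<close> is an eigenvector for \<open>M\<close>, or it vanishes and \<open>f\<close> is one
  for \<open>- M\<close>.
\<close>

section \<open>Norms of symmetric kernel operators\<close>

text \<open>A quadratic without constant term takes negative values near 0 unless its linear part
  vanishes. This replaces differentiation in the first-variation argument.\<close>

lemma linear_coeff_zero_of_nonneg_quadratic:
  fixes b q :: real
  assumes "\<And>t. 0 \<le> 2 * t * b + t\<^sup>2 * q"
  shows "b = 0"
proof (rule ccontr)
  assume b: "b \<noteq> 0"
  \<comment> \<open>Any positive \<open>s\<close> above \<open>q\<close> works: at
    \<open>t = - b / s\<close> the linear term then outweighs the quadratic one.\<close>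
  define s where "s = \<bar>q\<bar> + 1"
  have s: "s > 0" "q < s" by (auto simp: s_def)
  have "0 \<le> 2 * (- b / s) * b + (- b / s)\<^sup>2 * q" by (rule assms)
  also have "\<dots> = (b\<^sup>2 / s) * (q / s - 2)"
    using s by (simp add: power2_eq_square field_simps)
  also have "\<dots> < 0"
    using s b by (intro mult_pos_neg) (auto simp: field_simps)
  finally show False by simp
qed

text \<open>Condition \<open>sym\<close> makes \<open>T\<close> self-adjoint for \<open>ip\<close>.
  Functions are total, so \<open>closed\<close> refers to the product topology; with
  \<open>supp\<close> it makes the unit sphere of \<open>U\<close> compact, and the maximiser
  exists.\<close>

lemma symmetric_kernel_norm_le:
  fixes F :: "'b set" and m :: "'b \<Rightarrow> real" and K :: "'b \<Rightarrow> 'b \<Rightarrow> real"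
    and U :: "('b \<Rightarrow> real) set" and lam :: real
  defines "ip \<equiv> \<lambda>f g. \<Sum>v\<in>F. m v * f v * g v"
    and "T \<equiv> \<lambda>f v. if v \<in> F then \<Sum>u\<in>F. K v u * f u else 0"
  assumes fin: "finite F"
    and pos: "\<And>v. v \<in> F \<Longrightarrow> 0 < m v"
    and sym: "\<And>u v. u \<in> F \<Longrightarrow> v \<in> F \<Longrightarrow> m v * K v u = m u * K u v"
    and closed: "closed U"
    and supp: "\<And>f v. f \<in> U \<Longrightarrow> v \<notin> F \<Longrightarrow> f v = 0"
    and comb: "\<And>f g a b. f \<in> U \<Longrightarrow> g \<in> U \<Longrightarrow> (\<lambda>v. a * f v + b * g v) \<in> U"
    and inv: "\<And>f. f \<in> U \<Longrightarrow> T f \<in> U"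
    and lam: "0 \<le> lam"
    and eig: "\<And>\<kappa>. eigenvalue_on T U \<kappa> \<Longrightarrow> \<bar>\<kappa>\<bar> \<le> lam"
    and f: "f \<in> U"
  shows "ip (T f) (T f) \<le> lam\<^sup>2 * ip f f"
proof -
  have ip_comm: "ip f g = ip g f" for f g
    by (simp add: ip_def mult_ac)
  have ip_lin: "ip (\<lambda>v. a * f v + b * g v) h = a * ip f h + b * ip g h" for a b f g h
    by (simp add: ip_def sum_distrib_left sum.distrib algebra_simps)
  have ip_lin': "ip h (\<lambda>v. a * f v + b * g v) = a * ip h f + b * ip h g" for a b f g h
    by (simp add: ip_comm[of h] ip_lin)
  have T_lin: "T (\<lambda>v. a * f v + b * g v) = (\<lambda>v. a * T f v + b * T g v)" for a b f g
    by (rule ext) (simp add: T_def sum_distrib_left sum.distrib algebra_simps)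
  have term_nonneg: "0 \<le> m v * (f v * f v)" if "v \<in> F" for f v
    using pos[OF that] zero_le_square[of "f v"] by (simp add: zero_le_mult_iff)
  have ip_nonneg: "0 \<le> ip f f" for f
    unfolding ip_def mult.assoc by (intro sum_nonneg term_nonneg)
  have ip_eq_0: "f = (\<lambda>_. 0)" if "f \<in> U" "ip f f = 0" for f
  proof
    fix v
    have "\<forall>v\<in>F. m v * (f v * f v) = 0"
      using that(2) sum_nonneg_eq_0_iff[OF fin, of "\<lambda>v. m v * (f v * f v)"] term_nonneg
      unfolding ip_def mult.assoc by simp
    then show "f v = 0"
      using pos supp[OF that(1)] by (cases "v \<in> F") fastforce+
  qed
  have T_sym: "ip (T f) g = ip f (T g)" for f g
  proof -
    have "ip (T f) g = (\<Sum>v\<in>F. \<Sum>u\<in>F. m v * K v u * f u * g v)"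
      by (simp add: ip_def T_def sum_distrib_left sum_distrib_right mult_ac)
    also have "\<dots> = (\<Sum>v\<in>F. \<Sum>u\<in>F. m u * K u v * f u * g v)"
      by (intro sum.cong refl) (simp add: sym)
    also have "\<dots> = (\<Sum>u\<in>F. \<Sum>v\<in>F. m u * K u v * f u * g v)"
      by (rule sum.swap)
    also have "\<dots> = ip f (T g)"
      by (simp add: ip_def T_def sum_distrib_left sum_distrib_right mult_ac)
    finally show ?thesis .
  qed
  have cont_coord: "continuous_on UNIV (\<lambda>f :: 'b \<Rightarrow> real. f v)" for v
    by (rule continuous_on_product_coordinates)
  have cont_ip: "continuous_on UNIV (\<lambda>f. ip f f)"
    unfolding ip_def by (intro continuous_intros cont_coord)
  have cont_T: "continuous_on UNIV (\<lambda>f. ip (T f) (T f))"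
  proof -
    have "continuous_on UNIV (\<lambda>f. T f v)" for v
      unfolding T_def by (cases "v \<in> F") (auto intro!: continuous_intros cont_coord)
    then show ?thesis unfolding ip_def by (intro continuous_intros)
  qed
  show ?thesis
  proof (cases "ip f f = 0")
    case True
    then have "f = (\<lambda>_. 0)" using ip_eq_0 f by blast
    then show ?thesis by (simp add: ip_def T_def)
  next
    case False
    define S where "S = U \<inter> {f. ip f f = 1}"
    \<comment> \<open>A compact box around the unit sphere:
      \<open>m v * (h v)\<^sup>2 \<le> 1\<close> gives \<open>(h v)\<^sup>2 \<le> 1 / m v\<close>,
      and \<open>1 + 1 / m v\<close> bounds the root without taking it. Pinning the coordinates
      outside \<open>F\<close> to 0 lets Tychonoff apply.\<close>
    define C where "C = Pi\<^sub>E UNIV (\<lambda>v. if v \<in> F then {- (1 + 1 / m v)..1 + 1 / m v} else {0})"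
    have le_square: "e \<le> (1 + e)\<^sup>2" if "0 < e" for e :: real
      using that by (simp add: power2_sum)
    have "compact C"
    proof -
      have "compactin (product_topology (\<lambda>_. euclidean) UNIV) C"
        unfolding C_def compactin_PiE by auto
      then show ?thesis by (simp add: euclidean_product_topology)
    qed
    moreover have "closed S"
      unfolding S_def using closed cont_ip by (intro closed_Int closed_Collect_eq) auto
    moreover have "S \<subseteq> C"
    proof
      fix h assume h: "h \<in> S"
      have "\<bar>h v\<bar> \<le> 1 + 1 / m v" if v: "v \<in> F" for v
      proof -
        have d: "0 < 1 / m v" using pos[OF v] by simp
        have "m v * (h v * h v) \<le> ip h h"
          unfolding ip_def mult.assoc
          using member_le_sum[OF v, of "\<lambda>v. m v * (h v * h v)"] term_nonneg fin by simp
        then have "m v * (h v * h v) \<le> 1" using h by (simp add: S_def)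
        then have "(h v)\<^sup>2 \<le> 1 / m v"
          using pos[OF v] by (simp add: field_simps power2_eq_square)
        also have "\<dots> \<le> (1 + 1 / m v)\<^sup>2"
          using le_square[OF d] .
        finally have "\<bar>h v\<bar> \<le> \<bar>1 + 1 / m v\<bar>" by (simp only: abs_le_square_iff)
        then show ?thesis using d by linarith
      qed
      then show "h \<in> C"
        using h supp unfolding C_def S_def by (fastforce simp: abs_le_iff)
    qed
    ultimately have "compact S"
      using compact_Int_closed[of C S] by (simp add: Int_absorb1)
    have scale: "(\<lambda>v. a * h v) \<in> U" if "h \<in> U" for a h
      using comb[OF that that, of a 0] by simp
    have ip_scale: "ip (\<lambda>v. a * h v) (\<lambda>v. a * h v) = a\<^sup>2 * ip h h" for a h
      using ip_lin[of a h 0 h] ip_lin'[of _ a h 0 h] by (simp add: power2_eq_square)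
    have T_scale: "T (\<lambda>v. a * h v) = (\<lambda>v. a * T h v)" for a h
      using T_lin[of a h 0 h] by simp
    have normalise: "(\<lambda>v. (1 / sqrt (ip h h)) * h v) \<in> S" if "h \<in> U" "ip h h \<noteq> 0" for h
    proof -
      have "(1 / sqrt (ip h h))\<^sup>2 * ip h h = 1"
        using that(2) ip_nonneg[of h] by (simp add: power_divide)
      then show ?thesis using scale[OF that(1)] unfolding S_def ip_scale[symmetric] by blast
    qed
    have "S \<noteq> {}" using normalise[OF f False] by blast
    with \<open>compact S\<close> obtain f0 where f0: "f0 \<in> S" and
      max: "\<And>h. h \<in> S \<Longrightarrow> ip (T h) (T h) \<le> ip (T f0) (T f0)"
      using continuous_attains_sup[of S "\<lambda>f. ip (T f) (T f)"] continuous_on_subset[OF cont_T]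
      by blast
    define M where "M = sqrt (ip (T f0) (T f0))"
    have M: "0 \<le> M" "M\<^sup>2 = ip (T f0) (T f0)"
      using ip_nonneg by (auto simp: M_def)
    \<comment> \<open>Homogeneity carries the maximum on the unit sphere to all of
      \<open>U\<close>.\<close>
    have bound: "ip (T h) (T h) \<le> M\<^sup>2 * ip h h" if h: "h \<in> U" for h
    proof (cases "ip h h = 0")
      case True
      then have "h = (\<lambda>_. 0)" using ip_eq_0 h by blast
      then show ?thesis by (simp add: ip_def T_def)
    next
      case False
      from max[OF normalise[OF h False]] show ?thesis
        using False ip_nonneg[of h] unfolding T_scale ip_scale M(2)
        by (simp add: power_divide field_simps)
    qed
    have f0U: "f0 \<in> U" and f01: "ip f0 f0 = 1" using f0 by (auto simp: S_def)
    \<comment> \<open>The residual of \<open>T (T f0) = M\<^sup>2 * f0\<close>. Varying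
      \<open>f0\<close> in this very direction makes the linear coefficient equal to
      \<open>ip h h\<close>.\<close>
    define h where "h = (\<lambda>v. M\<^sup>2 * f0 v + (- 1) * T (T f0) v)"
    have hU: "h \<in> U" unfolding h_def by (intro comb inv f0U)
    \<comment> \<open>First variation: \<open>M\<^sup>2 \<parallel>g\<parallel>\<^sup>2 - \<parallel>T g\<parallel>\<^sup>2\<close> is nonnegative on \<open>U\<close> and vanishes at \<open>f0\<close>.\<close>
    have "M\<^sup>2 * ip f0 h - ip (T f0) (T h) = 0"
    proof (rule linear_coeff_zero_of_nonneg_quadratic)
      fix t :: real
      have "(\<lambda>v. 1 * f0 v + t * h v) \<in> U" by (intro comb f0U hU)
      from bound[OF this]
      show "0 \<le> 2 * t * (M\<^sup>2 * ip f0 h - ip (T f0) (T h)) + t\<^sup>2 * (M\<^sup>2 * ip h h - ip (T h) (T h))"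
        unfolding T_lin ip_lin ip_lin' f01 M(2)[symmetric] ip_comm[of h f0] ip_comm[of "T h" "T f0"]
        by (simp add: algebra_simps power2_eq_square)
    qed
    moreover have "ip h h = M\<^sup>2 * ip f0 h - ip (T f0) (T h)"
    proof -
      have "ip h h = M\<^sup>2 * ip f0 h + (-1) * ip (T (T f0)) h"
        by (subst (1) h_def) (rule ip_lin)
      then show ?thesis by (simp add: T_sym)
    qed
    ultimately have "h = (\<lambda>_. 0)" using ip_eq_0 hU by simp
    then have TT: "T (T f0) v = M\<^sup>2 * f0 v" for v
      unfolding h_def by (auto dest: fun_cong[of _ _ v])
    have f0_ne: "f0 \<noteq> (\<lambda>_. 0)" using f01 by (auto simp: ip_def)
    have "M \<le> lam"
    \<comment> \<open>Factors \<open>T\<^sup>2 - M\<^sup>2\<close> as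
      \<open>(T - M) (T + M)\<close>. The coefficient 1 gives the sum the shape of
      \<open>comb\<close> and \<open>T_lin\<close>.\<close>
    proof (cases "(\<lambda>v. 1 * T f0 v + M * f0 v) = (\<lambda>_. 0)")
      case True
      then have "T f0 = (\<lambda>v. (- M) * f0 v)"
        by (auto simp: fun_eq_iff add_eq_0_iff)
      then have "eigenvalue_on T U (- M)"
        using f0U f0_ne unfolding eigenvalue_on_def by blast
      then show ?thesis using eig M(1) by fastforce
    next
      case False
      have "T (\<lambda>v. 1 * T f0 v + M * f0 v) = (\<lambda>v. M * (1 * T f0 v + M * f0 v))"
        unfolding T_lin TT by (simp add: algebra_simps power2_eq_square)
      moreover have "(\<lambda>v. 1 * T f0 v + M * f0 v) \<in> U" by (intro comb inv f0U)
      ultimately have "eigenvalue_on T U M"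
        using False unfolding eigenvalue_on_def by blast
      then show ?thesis using eig by fastforce
    qed
    then have "M\<^sup>2 \<le> lam\<^sup>2" using M(1) by (simp add: power_mono)
    then have "M\<^sup>2 * ip f f \<le> lam\<^sup>2 * ip f f" by (rule mult_right_mono[OF _ ip_nonneg])
    with bound[OF f] show ?thesis by linarith
  qed
qed

text \<open>Absorbing \<open>sqrt (m v)\<close> into both functions reduces this to the unweighted
  inequality.\<close>

lemma weighted_Cauchy_Schwarz:
  fixes m f g :: "'b \<Rightarrow> real"
  assumes "\<And>v. v \<in> F \<Longrightarrow> 0 \<le> m v"
  shows "\<bar>\<Sum>v\<in>F. m v * f v * g v\<bar>
    \<le> sqrt (\<Sum>v\<in>F. m v * f v * f v) * sqrt (\<Sum>v\<in>F. m v * g v * g v)"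
proof -
  have eq: "(\<Sum>v\<in>F. m v * a v * b v) = (\<Sum>v\<in>F. (sqrt (m v) * a v) * (sqrt (m v) * b v))"
    for a b :: "'b \<Rightarrow> real"
  proof (intro sum.cong refl)
    fix v assume "v \<in> F"
    then have "m v = sqrt (m v) * sqrt (m v)" using assms by simp
    then show "m v * a v * b v = (sqrt (m v) * a v) * (sqrt (m v) * b v)"
      by (metis mult.assoc mult.left_commute)
  qed
  have "(\<Sum>v\<in>F. (sqrt (m v) * f v) * (sqrt (m v) * g v))\<^sup>2
      \<le> (\<Sum>v\<in>F. (sqrt (m v) * f v)\<^sup>2) * (\<Sum>v\<in>F. (sqrt (m v) * g v)\<^sup>2)"
    by (rule Cauchy_Schwarz_ineq_sum)
  then show ?thesis
    unfolding eq real_sqrt_mult[symmetric] power2_eq_square[of "sqrt _ * _", symmetric]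
    by (intro real_le_rsqrt) simp
qed

text \<open>Merges separate bounds on two squared norms into the single root of the final estimates;
  there \<open>c\<close> is \<open>r + 1\<close> or \<open>r\<close>.\<close>

lemma sqrt_mult_sqrt_le:
  fixes a b c p q :: real
  assumes "0 \<le> p" "0 \<le> q" "0 \<le> c" "p \<le> c * a" "q \<le> c * b"
  shows "sqrt p * sqrt q \<le> c * sqrt (a * b)"
proof -
  have "sqrt p * sqrt q \<le> sqrt (c * a) * sqrt (c * b)"
    using assms by (intro mult_mono) auto
  also have "\<dots> = sqrt (c\<^sup>2 * (a * b))"
    by (simp add: real_sqrt_mult[symmetric] power2_eq_square mult_ac)
  also have "\<dots> = c * sqrt (a * b)"
    using assms(3) by (simp add: real_sqrt_mult)
  finally show ?thesis .
qed

section \<open>Weights in partite complexes\<close>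

context weighted_partite_complex
begin

abbreviation "X0 \<equiv> faces_of_dim X 0"
abbreviation "X1 \<equiv> faces_of_dim X 1"
abbreviation "Top \<equiv> faces_of_dim X (int r)"
abbreviation "P \<equiv> part_faces X V"

text \<open>The symmetric kernel of the adjacency form, extended by 0 to pairs that span no edge, so
  that sums over edges become sums over all pairs.\<close>

definition half_edge_weight :: "'a set \<Rightarrow> 'a set \<Rightarrow> real" where
  "half_edge_weight u v = (if u \<union> v \<in> X1 then w (u \<union> v) / 2 else 0)"

lemma half_edge_weight_commute: "half_edge_weight u v = half_edge_weight v u"
  by (simp add: half_edge_weight_def Un_commute)

section \<open>Faces of given dimension and the splitting of vertices into parts\<close>

lemma mem_faces_0_iff: "v \<in> X0 \<longleftrightarrow> v \<in> X \<and> (\<exists>a. v = {a})"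
  by (auto simp: faces_of_dim_def face_dim_def card_1_singleton_iff)

lemma mem_faces_1_iff: "e \<in> X1 \<longleftrightarrow> e \<in> X \<and> card e = 2"
  by (auto simp: faces_of_dim_def face_dim_def)

lemma mem_top_iff: "y \<in> Top \<longleftrightarrow> y \<in> X \<and> card y = r + 1"
  by (auto simp: faces_of_dim_def face_dim_def)

lemma finite_faces [simp]: "finite (faces_of_dim X i)"
  using finite_complex by (simp add: faces_of_dim_def)

lemma part_subset_faces: "P i \<subseteq> X0"
  by (auto simp: part_faces_def)

lemma finite_part [simp]: "finite (P i)"
  using finite_subset[OF part_subset_faces] by simp

lemma parts_inter: "i \<le> r \<Longrightarrow> j \<le> r \<Longrightarrow> i \<noteq> j \<Longrightarrow> V i \<inter> V j = {}"
  using parts_disjoint unfolding disjoint_family_on_def by auto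

lemma part_faces_disjoint:
  "i \<le> r \<Longrightarrow> j \<le> r \<Longrightarrow> v \<in> P i \<Longrightarrow> v \<in> P j \<Longrightarrow> i = j"
  using parts_inter by (fastforce simp: part_faces_def mem_faces_0_iff)

lemma faces_0_eq_Union: "X0 = (\<Union>i\<in>{0..r}. P i)"
proof
  show "X0 \<subseteq> (\<Union>i\<in>{0..r}. P i)"
  proof
    fix v assume v: "v \<in> X0"
    then obtain a where "v = {a}" "a \<in> \<Union>X" by (auto simp: mem_faces_0_iff)
    then show "v \<in> (\<Union>i\<in>{0..r}. P i)"
      using v unfolding parts_cover[symmetric] part_faces_def by auto
  qed
qed (use part_subset_faces in auto)

lemma sum_faces_0: "(\<Sum>v\<in>X0. f v) = (\<Sum>i=0..r. \<Sum>v\<in>P i. f v)"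
  for f :: "'a set \<Rightarrow> real"
  unfolding faces_0_eq_Union
  using part_faces_disjoint by (intro sum.UNION_disjoint) auto

text \<open>The \<open>r + 1\<close> intersections with the parts have at most one vertex each and
  \<open>r + 1\<close> vertices together, so none is empty.\<close>

lemma card_top_part:
  assumes y: "y \<in> Top" and i: "i \<le> r"
  shows "card {u \<in> P i. u \<subseteq> y} = 1"
proof -
  have yX: "y \<in> X" and cy: "card y = r + 1" using y by (auto simp: mem_top_iff)
  have fin: "finite y" using yX finite_face by blast
  have "y = (\<Union>j\<in>{0..r}. y \<inter> V j)" using parts_cover yX by blast
  then have "card y = card (\<Union>j\<in>{0..r}. y \<inter> V j)" by simp
  also have "\<dots> = (\<Sum>j=0..r. card (y \<inter> V j))"
    using fin parts_inter by (intro card_UN_disjoint) fastforce+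
  finally have sum: "(\<Sum>j=0..r. card (y \<inter> V j)) = r + 1" using cy by simp
  have "card (y \<inter> V i) = 1"
  proof (rule ccontr)
    assume "card (y \<inter> V i) \<noteq> 1"
    then have "card (y \<inter> V i) < 1" using partite[OF yX, of i] i by auto
    then have "(\<Sum>j=0..r. card (y \<inter> V j)) < (\<Sum>j=0..r. 1)"
      using partite[OF yX] i by (intro sum_strict_mono_ex1) auto
    then show False using sum by simp
  qed
  moreover have "{u \<in> P i. u \<subseteq> y} = (\<lambda>a. {a}) ` (y \<inter> V i)"
    using subset_closed[OF yX] by (auto simp: part_faces_def mem_faces_0_iff)
  ultimately show ?thesis by (simp add: card_image)
qed

text \<open>Double counting: each \<open>y\<close> in \<open>F\<close> is counted once, by its only
  vertex in part \<open>i\<close>. It serves both for all top faces and for those through a fixed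
  vertex.\<close>

lemma sum_part_top:
  assumes "i \<le> r" and "F \<subseteq> Top"
  shows "(\<Sum>u\<in>P i. \<Sum>y\<in>{y \<in> F. u \<subseteq> y}. w y) = (\<Sum>y\<in>F. w y)"
proof -
  have fin: "finite F" using assms(2) finite_subset finite_faces by blast
  have "(\<Sum>u\<in>P i. \<Sum>y\<in>{y \<in> F. u \<subseteq> y}. w y) = (\<Sum>u\<in>P i. \<Sum>y\<in>F. if u \<subseteq> y then w y else 0)"
    using fin by (simp add: sum.If_cases Int_def)
  also have "\<dots> = (\<Sum>y\<in>F. \<Sum>u\<in>P i. if u \<subseteq> y then w y else 0)"
    by (rule sum.swap)
  also have "\<dots> = (\<Sum>y\<in>F. real (card {u \<in> P i. u \<subseteq> y}) * w y)"
    by (simp add: sum.If_cases Int_def)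
  also have "\<dots> = (\<Sum>y\<in>F. w y)"
    using assms card_top_part by (intro sum.cong) auto
  finally show ?thesis .
qed

lemma vertex_weight:
  assumes "1 \<le> r" and v: "v \<in> X0"
  shows "w v = (\<Sum>y\<in>{y \<in> Top. v \<subseteq> y}. w y) / (real r + 1)"
proof -
  have "v \<in> X" "card v = 1" using v by (auto simp: mem_faces_0_iff)
  then show ?thesis
    using weight_face[of v] assms(1) by (simp add: face_dim_def divide_inverse mult.commute add.commute)
qed

lemma edge_weight:
  assumes r: "1 \<le> r" and e: "e \<in> X1"
  shows "w e = 2 * (\<Sum>y\<in>{y \<in> Top. e \<subseteq> y}. w y) / (real r * (real r + 1))"
\<comment> \<open>For \<open>r = 1\<close> edges are top-dimensional, beyond the range of
  \<open>weight_face\<close>; the sum then has the single term \<open>w e\<close>, with factor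
  1.\<close>
proof (cases "r = 1")
  case True
  have "{y \<in> Top. e \<subseteq> y} = {e}"
    using e True card_subset_eq[of _ e] finite_face by (auto simp: mem_top_iff mem_faces_1_iff)
  then show ?thesis using True by simp
next
  case False
  have "2 * ((r + 1) choose 2) = r * (r + 1)"
    unfolding choose_two by simp
  then have "real (2 * ((r + 1) choose 2)) = real (r * (r + 1))" by (rule arg_cong)
  then have choose: "real ((r + 1) choose 2) = real r * (real r + 1) / 2"
    unfolding of_nat_mult of_nat_add by simp
  have "e \<in> X" "card e = 2" "face_dim e < int r"
    using e r False by (auto simp: mem_faces_1_iff face_dim_def)
  then have "w e = inverse (real ((r + 1) choose 2)) * (\<Sum>y\<in>{y \<in> Top. e \<subseteq> y}. w y)"
    using weight_face[of e] by simp
  then show ?thesis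
    unfolding choose by simp
qed

lemma part_weight:
  assumes "1 \<le> r" and "i \<le> r"
  shows "(\<Sum>v\<in>P i. w v) = 1 / (real r + 1)"
proof -
  have "(\<Sum>v\<in>P i. w v) = (\<Sum>v\<in>P i. (\<Sum>y\<in>{y \<in> Top. v \<subseteq> y}. w y) / (real r + 1))"
    using vertex_weight[OF assms(1)] part_subset_faces by (intro sum.cong) auto
  also have "\<dots> = 1 / (real r + 1)"
    unfolding sum_divide_distrib[symmetric] sum_part_top[OF assms(2) subset_refl] weight_top ..
  finally show ?thesis .
qed

text \<open>Two vertices of one part span no edge. Otherwise each top face through \<open>v\<close>
  has exactly one vertex in part \<open>j\<close>, so the total is
  \<open>(r + 1) * w v / (r * (r + 1))\<close>. This is the action of the operator on part
  indicators.\<close>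

lemma sum_half_edge_weight_part:
  assumes r: "1 \<le> r" and i: "i \<le> r" and j: "j \<le> r" and v: "v \<in> P i"
  shows "(\<Sum>u\<in>P j. half_edge_weight v u) = (if j = i then 0 else w v / real r)"
proof (cases "j = i")
  case True
  have "v \<union> u \<notin> X1" if u: "u \<in> P i" for u
  proof
    assume "v \<union> u \<in> X1"
    then have "v \<union> u \<in> X" "card (v \<union> u) = 2" by (auto simp: mem_faces_1_iff)
    moreover have "(v \<union> u) \<inter> V i = v \<union> u" using u v by (auto simp: part_faces_def)
    ultimately show False using partite[of "v \<union> u" i] i by auto
  qed
  then show ?thesis using True by (simp add: half_edge_weight_def)
next
  case False
  have vX0: "v \<in> X0" using v part_subset_faces by blast
  let ?F = "{y \<in> Top. v \<subseteq> y}"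
  \<comment> \<open>This covers non-edges too: a top face containing \<open>v\<close> and
    \<open>u\<close> would make \<open>v \<union> u\<close> a face, so both sides are 0.\<close>
  have "half_edge_weight v u = (\<Sum>y\<in>{y \<in> ?F. u \<subseteq> y}. w y) / (real r * (real r + 1))"
    if u: "u \<in> P j" for u
  proof (cases "v \<union> u \<in> X1")
    case True
    have "{y \<in> ?F. u \<subseteq> y} = {y \<in> Top. v \<union> u \<subseteq> y}" by auto
    then show ?thesis using edge_weight[OF r True] True by (simp add: half_edge_weight_def)
  next
    case notedge: False
    obtain a b where ab: "v = {a}" "u = {b}"
      using vX0 subsetD[OF part_subset_faces u] by (auto simp: mem_faces_0_iff)
    then have "a \<noteq> b" using False part_faces_disjoint[OF i j v] u by auto
    then have "card (v \<union> u) = 2" using ab by simp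
    then have "v \<union> u \<notin> X" using notedge by (simp add: mem_faces_1_iff)
    then have "{y \<in> ?F. u \<subseteq> y} = {}" using subset_closed by (auto simp: mem_top_iff)
    then show ?thesis using notedge by (simp add: half_edge_weight_def del: Collect_empty_eq)
  qed
  then have "(\<Sum>u\<in>P j. half_edge_weight v u)
      = (\<Sum>u\<in>P j. (\<Sum>y\<in>{y \<in> ?F. u \<subseteq> y}. w y) / (real r * (real r + 1)))"
    by (intro sum.cong) auto
  also have "\<dots> = (\<Sum>y\<in>?F. w y) / (real r * (real r + 1))"
    unfolding sum_divide_distrib[symmetric] by (subst sum_part_top[OF j]) auto
  also have "\<dots> = w v / real r"
    unfolding vertex_weight[OF r vX0] by simp
  finally show ?thesis using False by simp
qed

section \<open>The adjacency operator on the diamond space\<close>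

text \<open>Edges through \<open>v\<close> correspond to their other ends by \<open>e - v\<close>,
  with inverse \<open>v \<union> u\<close>. The result is the kernel form required by
  \<open>symmetric_kernel_norm_le\<close>.\<close>

lemma weighted_adjacency_eq:
  "weighted_adjacency X w f
    = (\<lambda>v. if v \<in> X0 then \<Sum>u\<in>X0. half_edge_weight v u / w v * f u else 0)"
proof
  fix v
  show "weighted_adjacency X w f v
      = (if v \<in> X0 then \<Sum>u\<in>X0. half_edge_weight v u / w v * f u else 0)"
  proof (cases "v \<in> X0")
    case True
    then obtain a where a: "v = {a}" by (auto simp: mem_faces_0_iff)
    have "(\<Sum>e\<in>{e \<in> X1. v \<subseteq> e}. w e / (2 * w v) * f (e - v))
        = (\<Sum>u\<in>{u \<in> X0. v \<union> u \<in> X1}. w (v \<union> u) / (2 * w v) * f u)"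
    proof (rule sum.reindex_bij_witness[where i = "\<lambda>u. v \<union> u" and j = "\<lambda>e. e - v"])
      fix e assume e: "e \<in> {e \<in> X1. v \<subseteq> e}"
      then show un: "v \<union> (e - v) = e" by auto
      have "card (e - v) = 1" using e a by (simp add: mem_faces_1_iff)
      then show "e - v \<in> {u \<in> X0. v \<union> u \<in> X1}"
        using e un subset_closed[of e "e - v"]
        by (auto simp: mem_faces_0_iff mem_faces_1_iff card_1_singleton_iff)
      show "w (v \<union> (e - v)) / (2 * w v) * f (e - v) = w e / (2 * w v) * f (e - v)"
        by (simp only: un)
    next
      fix u assume u: "u \<in> {u \<in> X0. v \<union> u \<in> X1}"
      then obtain b where b: "u = {b}" by (auto simp: mem_faces_0_iff)
      have "a \<noteq> b" using u a b by (auto simp: mem_faces_1_iff)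
      then show "v \<union> u - v = u" using a b by auto
      show "v \<union> u \<in> {e \<in> X1. v \<subseteq> e}" using u by auto
    qed
    also have "\<dots> = (\<Sum>u\<in>X0. half_edge_weight v u / w v * f u)"
      by (rule sum.mono_neutral_cong_left) (auto simp: half_edge_weight_def)
    finally show ?thesis using True by (simp add: weighted_adjacency_def)
  qed (simp add: weighted_adjacency_def)
qed

lemma part_step_eq:
  assumes "j \<le> r" and "v \<in> P j"
  shows "(\<Sum>i=0..r. c i * indicator (P i) v) = (c j :: real)"
proof -
  have "(\<Sum>i=0..r. c i * indicator (P i) v) = (\<Sum>i=0..r. if i = j then c i else 0)"
    using assms part_faces_disjoint by (intro sum.cong refl) (auto simp: indicator_def)
  then show ?thesis using assms(1) by simp
qed

text \<open>Pairing with a step function combines the weighted sums over the parts linearly, and the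
  coefficients that are 1 at \<open>i\<close> and 0 elsewhere isolate one of them.\<close>

lemma diamond_space_iff:
  "f \<in> diamond_space r X V w \<longleftrightarrow>
    (\<forall>v. v \<notin> X0 \<longrightarrow> f v = 0) \<and> (\<forall>i\<in>{0..r}. (\<Sum>v\<in>P i. w v * f v) = 0)"
proof -
  have inner: "weighted_inner X w f (\<lambda>v. \<Sum>i=0..r. c i * indicator (P i) v)
      = (\<Sum>i=0..r. c i * (\<Sum>v\<in>P i. w v * f v))" for c
    unfolding weighted_inner_def sum_faces_0
  proof (intro sum.cong refl)
    fix j assume j: "j \<in> {0..r}"
    have "(\<Sum>v\<in>P j. w v * f v * (\<Sum>i=0..r. c i * indicator (P i) v)) = (\<Sum>v\<in>P j. c j * (w v * f v))"
      using j by (intro sum.cong refl) (simp add: part_step_eq)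
    then show "(\<Sum>v\<in>P j. w v * f v * (\<Sum>i=0..r. c i * indicator (P i) v)) = c j * (\<Sum>v\<in>P j. w v * f v)"
      by (simp add: sum_distrib_left)
  qed
  have "(\<forall>c. (\<Sum>i=0..r. c i * (\<Sum>v\<in>P i. w v * f v)) = 0)
      \<longleftrightarrow> (\<forall>i\<in>{0..r}. (\<Sum>v\<in>P i. w v * f v) = 0)"
  proof (intro iffI ballI allI)
    fix i assume *: "\<forall>c. (\<Sum>i=0..r. c i * (\<Sum>v\<in>P i. w v * f v)) = 0" and i: "i \<in> {0..r}"
    show "(\<Sum>v\<in>P i. w v * f v) = 0"
      using *[rule_format, of "\<lambda>j. if j = i then 1 else 0"] i by (simp add: if_distrib[of "\<lambda>x. x * _"] cong: if_cong)
  qed simp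
  then show ?thesis
    unfolding diamond_space_def part_indicator_span_def vertex_functions_def inner[symmetric]
    by auto
qed

text \<open>Membership is a family of linear equations in finitely many coordinates each.\<close>

lemma closed_diamond_space: "closed (diamond_space r X V w)"
proof -
  have "diamond_space r X V w = (\<Inter>v\<in>- X0. {f. f v = 0}) \<inter>
      (\<Inter>i\<in>{0..r}. {f. (\<Sum>v\<in>P i. w v * f v) = 0})"
    by (auto simp: diamond_space_iff)
  also have "closed \<dots>"
    by (intro closed_Int closed_INT ballI closed_Collect_eq continuous_intros
        continuous_on_product_coordinates)
  finally show ?thesis .
qed

text \<open>By symmetry of the kernel, the weighted sum of the image over a part combines the part
  sums of \<open>f\<close> with coefficients 0 and \<open>1 / r\<close>, and these all
  vanish.\<close>

lemma weighted_adjacency_diamond: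
  assumes r: "1 \<le> r" and f: "f \<in> diamond_space r X V w"
  shows "weighted_adjacency X w f \<in> diamond_space r X V w"
  unfolding diamond_space_iff
proof (intro conjI allI impI ballI)
  fix i assume i: "i \<in> {0..r}"
  have "(\<Sum>v\<in>P i. w v * weighted_adjacency X w f v)
      = (\<Sum>v\<in>P i. \<Sum>u\<in>X0. half_edge_weight u v * f u)"
  proof (intro sum.cong refl)
    fix v assume "v \<in> P i"
    then have v: "v \<in> X0" using part_subset_faces by blast
    show "w v * weighted_adjacency X w f v = (\<Sum>u\<in>X0. half_edge_weight u v * f u)"
      unfolding weighted_adjacency_eq using v weight_vertex_pos[OF v]
      by (simp add: sum_distrib_left half_edge_weight_commute[of v])
  qed
  also have "\<dots> = (\<Sum>u\<in>X0. (\<Sum>v\<in>P i. half_edge_weight u v) * f u)"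
    by (subst sum.swap) (simp add: sum_distrib_right)
  also have "\<dots> = (\<Sum>j=0..r. \<Sum>u\<in>P j. (if i = j then 0 else w u / real r) * f u)"
    unfolding sum_faces_0 using i by (intro sum.cong refl) (simp add: sum_half_edge_weight_part[OF r])
  also have "\<dots> = (\<Sum>j=0..r. (if i = j then 0 else 1 / real r) * (\<Sum>u\<in>P j. w u * f u))"
    unfolding sum_distrib_left by (intro sum.cong refl) auto
  also have "\<dots> = 0"
    using f by (simp add: diamond_space_iff)
  finally show "(\<Sum>v\<in>P i. w v * weighted_adjacency X w f v) = 0" .
qed (simp add: weighted_adjacency_def)

text \<open>Cauchy-Schwarz for the image of \<open>f\<close> against \<open>g\<close>, then the norm
  bound for the image.\<close>

lemma adjacency_form_le:
  assumes r: "1 \<le> r" and ex: "partite_expander r X V w (- lam) lam"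
    and f: "f \<in> diamond_space r X V w" and g: "g \<in> diamond_space r X V w"
  shows "\<bar>\<Sum>v\<in>X0. \<Sum>u\<in>X0. half_edge_weight v u * f u * g v\<bar>
    \<le> lam * sqrt (\<Sum>v\<in>X0. w v * f v * f v) * sqrt (\<Sum>v\<in>X0. w v * g v * g v)"
proof -
  let ?T = "weighted_adjacency X w" and ?U = "diamond_space r X V w"
  \<comment> \<open>Comes from \<open>- lam \<le> lam\<close> in the notion of expander, hence holds
    even if the diamond space is zero.\<close>
  have lam: "0 \<le> lam" using ex by (simp add: partite_expander_def)
  have T_eq: "(\<lambda>f v. if v \<in> X0 then \<Sum>u\<in>X0. half_edge_weight v u / w v * f u else 0) = ?T"
    by (simp add: weighted_adjacency_eq fun_eq_iff)
  have T_norm: "(\<Sum>v\<in>X0. w v * ?T f v * ?T f v) \<le> lam\<^sup>2 * (\<Sum>v\<in>X0. w v * f v * f v)"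
    unfolding weighted_adjacency_eq
  proof (rule symmetric_kernel_norm_le[where U = ?U])
    show "w v * (half_edge_weight v u / w v) = w u * (half_edge_weight u v / w u)"
      if "u \<in> X0" "v \<in> X0" for u v
      using weight_vertex_pos[OF that(1)] weight_vertex_pos[OF that(2)]
      by (simp add: half_edge_weight_commute)
    show "\<bar>\<kappa>\<bar> \<le> lam"
      if "eigenvalue_on (\<lambda>f v. if v \<in> X0 then \<Sum>u\<in>X0. half_edge_weight v u / w v * f u else 0) ?U \<kappa>"
      for \<kappa>
      using that ex unfolding T_eq partite_expander_def by fastforce
    show "(\<lambda>v. if v \<in> X0 then \<Sum>u\<in>X0. half_edge_weight v u / w v * h u else 0) \<in> ?U"
      if "h \<in> ?U" for h
      using weighted_adjacency_diamond[OF r that] unfolding weighted_adjacency_eq .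
    show "(\<lambda>v. a * h v + b * k v) \<in> ?U" if "h \<in> ?U" "k \<in> ?U" for h k and a b :: real
      using that unfolding diamond_space_iff
      by (simp add: algebra_simps sum.distrib flip: sum_distrib_left)
  qed (use lam f closed_diamond_space weight_vertex_pos in \<open>auto simp: diamond_space_iff\<close>)
  have "(\<Sum>v\<in>X0. \<Sum>u\<in>X0. half_edge_weight v u * f u * g v) = (\<Sum>v\<in>X0. w v * ?T f v * g v)"
  proof (intro sum.cong refl)
    fix v assume v: "v \<in> X0"
    show "(\<Sum>u\<in>X0. half_edge_weight v u * f u * g v) = w v * ?T f v * g v"
      using v weight_vertex_pos[OF v] unfolding weighted_adjacency_eq
      by (simp add: sum_distrib_left sum_distrib_right)
  qed
  also have "\<bar>\<dots>\<bar> \<le> sqrt (\<Sum>v\<in>X0. w v * ?T f v * ?T f v) * sqrt (\<Sum>v\<in>X0. w v * g v * g v)"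
    using weight_vertex_pos by (intro weighted_Cauchy_Schwarz) (simp add: less_imp_le)
  also have "\<dots> \<le> sqrt (lam\<^sup>2 * (\<Sum>v\<in>X0. w v * f v * f v)) * sqrt (\<Sum>v\<in>X0. w v * g v * g v)"
    using T_norm weight_vertex_pos
    by (intro mult_right_mono real_sqrt_le_mono real_sqrt_ge_zero sum_nonneg)
      (auto simp: mult.assoc less_imp_le)
  also have "\<dots> = lam * sqrt (\<Sum>v\<in>X0. w v * f v * f v) * sqrt (\<Sum>v\<in>X0. w v * g v * g v)"
    using lam by (simp add: real_sqrt_mult)
  finally show ?thesis .
qed

section \<open>Mixing\<close>

lemma sum_part_indicator:
  "(\<Sum>v\<in>P i. w v * indicator A v) = set_weight w (A \<inter> P i)"
  by (simp add: set_weight_def Int_commute sum_mult_indicator)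

lemma set_weight_eq_sum_parts:
  assumes "A \<subseteq> X0"
  shows "set_weight w A = (\<Sum>i=0..r. set_weight w (A \<inter> P i))"
proof -
  have "set_weight w A = (\<Sum>v\<in>X0. w v * indicator A v)"
    using assms by (simp add: set_weight_def sum_mult_indicator Int_absorb1)
  then show ?thesis by (simp add: sum_faces_0 sum_part_indicator)
qed

lemma set_weight_vertices_nonneg:
  "A \<subseteq> X0 \<Longrightarrow> 0 \<le> set_weight w A"
  unfolding set_weight_def using weight_vertex_pos by (intro sum_nonneg) (auto intro: less_imp_le)

text \<open>The orthogonal projection of the indicator of \<open>A\<close> to the diamond space; every part has
  weight \<open>1 / (r + 1)\<close>.\<close>

definition centred_indicator :: "'a set set \<Rightarrow> 'a set \<Rightarrow> real" where
  "centred_indicator A v = indicator A v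
    - (\<Sum>i=0..r. (real r + 1) * set_weight w (A \<inter> P i) * indicator (P i) v)"

lemma centred_indicator_part:
  assumes "i \<le> r" and "v \<in> P i"
  shows "centred_indicator A v = indicator A v - (real r + 1) * set_weight w (A \<inter> P i)"
  using part_step_eq[OF assms, of "\<lambda>i. (real r + 1) * set_weight w (A \<inter> P i)"]
  by (simp add: centred_indicator_def)

lemma centred_indicator_diamond:
  assumes r: "1 \<le> r" and A: "A \<subseteq> X0"
  shows "centred_indicator A \<in> diamond_space r X V w"
  unfolding diamond_space_iff
proof (intro conjI allI impI ballI)
  fix v assume v: "v \<notin> X0"
  then have "v \<notin> A" "\<And>i. v \<notin> P i" using A part_subset_faces by blast+
  then show "centred_indicator A v = 0" by (simp add: centred_indicator_def)
next
  fix i assume i: "i \<in> {0..r}"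
  let ?s = "(real r + 1) * set_weight w (A \<inter> P i)"
  have "(\<Sum>v\<in>P i. w v * centred_indicator A v) = (\<Sum>v\<in>P i. w v * indicator A v - ?s * w v)"
    using i by (intro sum.cong refl) (simp add: centred_indicator_part algebra_simps)
  also have "\<dots> = set_weight w (A \<inter> P i) - ?s * (\<Sum>v\<in>P i. w v)"
    by (simp add: sum_subtractf sum_part_indicator sum_distrib_left)
  also have "\<dots> = 0"
    using part_weight[OF r] i by simp
  finally show "(\<Sum>v\<in>P i. w v * centred_indicator A v) = 0" .
qed

text \<open>A variance on each part: with \<open>a\<close> the weight of \<open>A\<close> in the
  part and \<open>s = (r + 1) * a\<close>, the square expands to
  \<open>a - 2 * s * a + s\<^sup>2 / (r + 1)\<close>, because an indicator equals its
  square.\<close>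

lemma centred_indicator_norm:
  assumes r: "1 \<le> r" and A: "A \<subseteq> X0"
  shows "(\<Sum>v\<in>X0. w v * centred_indicator A v * centred_indicator A v)
    = set_weight w A - (real r + 1) * (\<Sum>i=0..r. (set_weight w (A \<inter> P i))\<^sup>2)"
proof -
  have "(\<Sum>v\<in>P i. w v * centred_indicator A v * centred_indicator A v)
      = set_weight w (A \<inter> P i) - (real r + 1) * (set_weight w (A \<inter> P i))\<^sup>2"
    if i: "i \<in> {0..r}" for i
  proof -
    let ?s = "(real r + 1) * set_weight w (A \<inter> P i)"
    have "(\<Sum>v\<in>P i. w v * centred_indicator A v * centred_indicator A v)
        = (\<Sum>v\<in>P i. (1 - 2 * ?s) * (w v * indicator A v) + ?s\<^sup>2 * w v)"
      using i by (intro sum.cong refl)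
        (auto simp: centred_indicator_part indicator_def algebra_simps power2_eq_square)
    also have "\<dots> = (1 - 2 * ?s) * set_weight w (A \<inter> P i) + ?s\<^sup>2 * (1 / (real r + 1))"
      using part_weight[OF r, of i] i
      by (simp add: sum.distrib sum_part_indicator flip: sum_distrib_left)
    also have "?s\<^sup>2 * (1 / (real r + 1)) = (real r + 1) * (set_weight w (A \<inter> P i))\<^sup>2"
      by (simp add: power2_eq_square)
    finally show ?thesis by (simp add: algebra_simps power2_eq_square)
  qed
  then have "(\<Sum>v\<in>X0. w v * centred_indicator A v * centred_indicator A v)
      = (\<Sum>i=0..r. set_weight w (A \<inter> P i) - (real r + 1) * (set_weight w (A \<inter> P i))\<^sup>2)"
    unfolding sum_faces_0 by (intro sum.cong) auto
  also have "\<dots> = set_weight w A - (real r + 1) * (\<Sum>i=0..r. (set_weight w (A \<inter> P i))\<^sup>2)"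
    by (simp add: sum_subtractf sum_distrib_left set_weight_eq_sum_parts[OF A])
  finally show ?thesis .
qed

section \<open>The adjacency form on pairs of parts\<close>

lemma sum_half_edge_weight_parts:
  assumes "1 \<le> r" and "i \<le> r" and "j \<le> r"
  shows "(\<Sum>v\<in>P j. \<Sum>u\<in>P i. half_edge_weight v u * y v)
    = (if i = j then 0 else (\<Sum>v\<in>P j. w v * y v) / real r)"
proof -
  have "(\<Sum>v\<in>P j. \<Sum>u\<in>P i. half_edge_weight v u * y v)
      = (\<Sum>v\<in>P j. (if i = j then 0 else w v / real r) * y v)"
    using assms by (intro sum.cong refl)
      (simp add: sum_half_edge_weight_part flip: sum_distrib_right)
  also have "\<dots> = (if i = j then 0 else (\<Sum>v\<in>P j. w v * y v) / real r)"
    by (simp add: sum_divide_distrib)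
  finally show ?thesis .
qed

text \<open>For distinct parts, each of the two mixed terms contributes
  \<open>- (r + 1) / r * a * b\<close> and the constant term \<open>+ (r + 1) / r * a * b\<close>,
  leaving one negative copy.\<close>

lemma adjacency_form_centred_parts:
  assumes r: "1 \<le> r" and i: "i \<le> r" and j: "j \<le> r"
  shows "(\<Sum>v\<in>P j. \<Sum>u\<in>P i. half_edge_weight v u * centred_indicator A u * centred_indicator B v)
    = (\<Sum>v\<in>P j. \<Sum>u\<in>P i. half_edge_weight v u * indicator A u * indicator B v)
      - (if i = j then 0
         else (real r + 1) / real r * (set_weight w (A \<inter> P i) * set_weight w (B \<inter> P j)))"
proof -
  let ?a = "set_weight w (A \<inter> P i)" and ?b = "set_weight w (B \<inter> P j)"
  let ?s = "(real r + 1) * ?a" and ?t = "(real r + 1) * ?b"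
  let ?h = half_edge_weight
  have "(\<Sum>v\<in>P j. \<Sum>u\<in>P i. ?h v u * centred_indicator A u * centred_indicator B v)
      = (\<Sum>v\<in>P j. \<Sum>u\<in>P i. ?h v u * indicator A u * indicator B v
          - ?s * (?h v u * indicator B v) - ?t * (?h v u * indicator A u) + ?s * ?t * (?h v u * 1))"
    using i j by (intro sum.cong refl) (simp add: centred_indicator_part algebra_simps)
  also have "\<dots> = (\<Sum>v\<in>P j. \<Sum>u\<in>P i. ?h v u * indicator A u * indicator B v)
      - ?s * (\<Sum>v\<in>P j. \<Sum>u\<in>P i. ?h v u * indicator B v)
      - ?t * (\<Sum>v\<in>P j. \<Sum>u\<in>P i. ?h v u * indicator A u)
      + ?s * ?t * (\<Sum>v\<in>P j. \<Sum>u\<in>P i. ?h v u * 1)"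
    unfolding sum.distrib sum_subtractf sum_distrib_left ..
  also have "(\<Sum>v\<in>P j. \<Sum>u\<in>P i. ?h v u * indicator B v) = (if i = j then 0 else ?b / real r)"
    unfolding sum_half_edge_weight_parts[OF r i j] sum_part_indicator ..
  \<comment> \<open>The factor depends on the inner variable, so the sums are swapped to fit
    \<open>sum_half_edge_weight_parts\<close>.\<close>
  also have "(\<Sum>v\<in>P j. \<Sum>u\<in>P i. ?h v u * indicator A u)
      = (\<Sum>u\<in>P i. \<Sum>v\<in>P j. ?h u v * indicator A u)"
    by (subst sum.swap) (simp only: half_edge_weight_commute)
  also have "\<dots> = (if i = j then 0 else ?a / real r)"
    unfolding sum_half_edge_weight_parts[OF r j i] sum_part_indicator by auto
  also have "(\<Sum>v\<in>P j. \<Sum>u\<in>P i. ?h v u * 1)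
      = (if i = j then 0 else 1 / (real r + 1) / real r)"
    unfolding sum_half_edge_weight_parts[OF r i j] using part_weight[OF r j] by simp
  finally have expansion: "(\<Sum>v\<in>P j. \<Sum>u\<in>P i. ?h v u * centred_indicator A u * centred_indicator B v)
      = (\<Sum>v\<in>P j. \<Sum>u\<in>P i. ?h v u * indicator A u * indicator B v)
        - ?s * (if i = j then 0 else ?b / real r) - ?t * (if i = j then 0 else ?a / real r)
        + ?s * ?t * (if i = j then 0 else 1 / (real r + 1) / real r)" .
  have cancel: "x - (R + 1) * a * (b / R) - (R + 1) * b * (a / R)
        + (R + 1) * a * ((R + 1) * b) * (1 / (R + 1) / R) = x - (R + 1) / R * (a * b)"
    if "0 < R" for x a b R :: real
    using that by (simp add: divide_simps)
  show ?thesis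
  proof (cases "i = j")
    case True
    then show ?thesis unfolding expansion by simp
  next
    case False
    then show ?thesis using r unfolding expansion by (simp only: if_False cancel of_nat_0_less_iff Suc_le_eq One_nat_def)
  qed
qed

text \<open>Only pairs in \<open>A \<times> B\<close> spanning an edge survive; an edge with both
  ends in \<open>A \<inter> B\<close> enters in both orders, as in the ordered edge set.\<close>

lemma adjacency_form_indicators:
  assumes A: "A \<subseteq> X0" and B: "B \<subseteq> X0"
  shows "(\<Sum>v\<in>X0. \<Sum>u\<in>X0. half_edge_weight v u * indicator A u * indicator B v)
    = 1/2 * ordered_set_weight w (ordered_edges_between X A B)"
proof -
  have sub: "ordered_edges_between X A B \<subseteq> X0 \<times> X0"
    using A B by (auto simp: ordered_edges_between_def)
  have "(\<Sum>v\<in>X0. \<Sum>u\<in>X0. half_edge_weight v u * indicator A u * indicator B v)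
      = (\<Sum>u\<in>X0. \<Sum>v\<in>X0. half_edge_weight v u * indicator A u * indicator B v)"
    by (rule sum.swap)
  also have "\<dots> = (\<Sum>(u, v)\<in>X0 \<times> X0. half_edge_weight v u * indicator A u * indicator B v)"
    by (rule sum.cartesian_product)
  also have "\<dots> = (\<Sum>(u, v)\<in>ordered_edges_between X A B. w (u \<union> v) / 2)"
    using sub by (intro sum.mono_neutral_cong_right)
      (auto simp: ordered_edges_between_def half_edge_weight_def Un_commute indicator_def
          split: if_splits)
  also have "\<dots> = 1/2 * ordered_set_weight w (ordered_edges_between X A B)"
    by (simp add: ordered_set_weight_def sum_distrib_left case_prod_unfold)
  finally show ?thesis .
qed

text \<open>The common source of both estimates, with the exact norms of the projections on the
  right. The main term lacks the diagonal because no edge lies inside a part.\<close>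

lemma mixing_centred:
  assumes r: "1 \<le> r" and ex: "partite_expander r X V w (- lam) lam"
    and A: "A \<subseteq> X0" and B: "B \<subseteq> X0"
  shows "\<bar>1/2 * ordered_set_weight w (ordered_edges_between X A B)
      - (real r + 1) / real r * (set_weight w A * set_weight w B
          - (\<Sum>i=0..r. set_weight w (A \<inter> P i) * set_weight w (B \<inter> P i)))\<bar>
    \<le> lam * sqrt (set_weight w A - (real r + 1) * (\<Sum>i=0..r. (set_weight w (A \<inter> P i))\<^sup>2))
          * sqrt (set_weight w B - (real r + 1) * (\<Sum>i=0..r. (set_weight w (B \<inter> P i))\<^sup>2))"
proof -
  let ?a = "\<lambda>i. set_weight w (A \<inter> P i)" and ?b = "\<lambda>i. set_weight w (B \<inter> P i)"
  let ?c = "(real r + 1) / real r"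
  have split: "(\<Sum>v\<in>X0. \<Sum>u\<in>X0. f v u) = (\<Sum>j=0..r. \<Sum>i=0..r. \<Sum>v\<in>P j. \<Sum>u\<in>P i. f v u)"
    for f :: "'a set \<Rightarrow> 'a set \<Rightarrow> real"
    unfolding sum_faces_0 by (intro sum.cong refl sum.swap)
  have "(\<Sum>v\<in>X0. \<Sum>u\<in>X0. half_edge_weight v u * centred_indicator A u * centred_indicator B v)
      = (\<Sum>j=0..r. \<Sum>i=0..r. (\<Sum>v\<in>P j. \<Sum>u\<in>P i. half_edge_weight v u * indicator A u * indicator B v)
          - (if i = j then 0 else ?c * (?a i * ?b j)))"
    unfolding split by (intro sum.cong refl adjacency_form_centred_parts[OF r]) auto
  also have "\<dots> = (\<Sum>v\<in>X0. \<Sum>u\<in>X0. half_edge_weight v u * indicator A u * indicator B v)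
      - (\<Sum>j=0..r. \<Sum>i=0..r. if i = j then 0 else ?c * (?a i * ?b j))"
    unfolding split sum_subtractf ..
  \<comment> \<open>Completing the off-diagonal sum makes it a product of total weights minus the
    diagonal.\<close>
  also have "(\<Sum>j=0..r. \<Sum>i=0..r. if i = j then 0 else ?c * (?a i * ?b j))
      = (\<Sum>j=0..r. \<Sum>i=0..r. ?c * (?a i * ?b j) - (if i = j then ?c * (?a i * ?b j) else 0))"
    by (intro sum.cong refl) simp
  also have "\<dots> = (\<Sum>j=0..r. \<Sum>i=0..r. ?c * (?a i * ?b j)) - (\<Sum>j=0..r. ?c * (?a j * ?b j))"
    unfolding sum_subtractf by simp
  also have "(\<Sum>j=0..r. \<Sum>i=0..r. ?c * (?a i * ?b j)) = ?c * (set_weight w A * set_weight w B)"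
    unfolding set_weight_eq_sum_parts[OF A] set_weight_eq_sum_parts[OF B] sum_product
    unfolding sum_distrib_left
    by (rule sum.swap)
  finally have "(\<Sum>v\<in>X0. \<Sum>u\<in>X0. half_edge_weight v u * centred_indicator A u * centred_indicator B v)
      = 1/2 * ordered_set_weight w (ordered_edges_between X A B)
        - ?c * (set_weight w A * set_weight w B - (\<Sum>i=0..r. ?a i * ?b i))"
    unfolding adjacency_form_indicators[OF A B] right_diff_distrib sum_distrib_left .
  then show ?thesis
    using adjacency_form_le[OF r ex centred_indicator_diamond[OF r A] centred_indicator_diamond[OF r B]]
    by (simp only: centred_indicator_norm[OF r A] centred_indicator_norm[OF r B])
qed

section \<open>Norm bounds and the passage to unordered edges\<close>

text \<open>Cauchy-Schwarz against the constant 1 over the parts in \<open>T\<close>. Multiplying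
  through by \<open>card T\<close> avoids a division by 0 when \<open>T\<close> is empty.\<close>

lemma centred_norm_bound:
  assumes r: "1 \<le> r" and T: "T \<subseteq> {0..r}" and A: "A \<subseteq> (\<Union>i\<in>T. P i)"
  shows "real (card T) * (set_weight w A - (real r + 1) * (\<Sum>i=0..r. (set_weight w (A \<inter> P i))\<^sup>2))
    \<le> set_weight w A * (real (card T) - (real r + 1) * set_weight w A)"
proof -
  let ?a = "\<lambda>i. set_weight w (A \<inter> P i)"
  have AX: "A \<subseteq> X0" using A part_subset_faces by blast
  have "A \<inter> P i = {}" if "i \<in> {0..r} - T" for i
    using that A T part_faces_disjoint by fastforce
  then have zero: "\<forall>i\<in>{0..r} - T. ?a i = 0" by (simp add: set_weight_def)
  have "set_weight w A = (\<Sum>i\<in>T. ?a i)"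
    unfolding set_weight_eq_sum_parts[OF AX] using zero T by (intro sum.mono_neutral_right) auto
  moreover have "(\<Sum>i=0..r. (?a i)\<^sup>2) = (\<Sum>i\<in>T. (?a i)\<^sup>2)"
    using zero T by (intro sum.mono_neutral_right) auto
  moreover have "(\<Sum>i\<in>T. ?a i)\<^sup>2 \<le> real (card T) * (\<Sum>i\<in>T. (?a i)\<^sup>2)"
    using Cauchy_Schwarz_ineq_sum[of "\<lambda>_. 1" ?a T] by simp
  ultimately have "(real r + 1) * (set_weight w A)\<^sup>2
      \<le> (real r + 1) * (real (card T) * (\<Sum>i=0..r. (?a i)\<^sup>2))"
    by (intro mult_left_mono) auto
  then show ?thesis by (simp add: algebra_simps power2_eq_square)
qed

lemma centred_norm_nonneg:
  assumes "1 \<le> r" and "A \<subseteq> X0"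
  shows "0 \<le> set_weight w A - (real r + 1) * (\<Sum>i=0..r. (set_weight w (A \<inter> P i))\<^sup>2)"
  unfolding centred_indicator_norm[OF assms, symmetric] mult.assoc
  by (intro sum_nonneg mult_nonneg_nonneg[OF less_imp_le zero_le_square] weight_vertex_pos)

text \<open>Disjointness tells the end in \<open>A\<close> from the end in \<open>B\<close>, so an
  edge determines its ordered pair.\<close>

lemma set_weight_edges_between:
  assumes A: "A \<subseteq> X0" and B: "B \<subseteq> X0" and disj: "A \<inter> B = {}"
  shows "set_weight w (edges_between X A B) = ordered_set_weight w (ordered_edges_between X A B)"
proof -
  have "edges_between X A B = (\<lambda>(u, v). u \<union> v) ` ordered_edges_between X A B"
    by (auto simp: edges_between_def ordered_edges_between_def image_iff)
  moreover have "inj_on (\<lambda>(u, v). u \<union> v) (ordered_edges_between X A B)"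
  proof (rule inj_onI, clarsimp simp: ordered_edges_between_def)
    fix u v u' v'
    assume uv: "u \<in> A" "v \<in> B" "u' \<in> A" "v' \<in> B" and eq: "u \<union> v = u' \<union> v'"
    obtain a b a' b' where "u = {a}" "v = {b}" "u' = {a'}" "v' = {b'}"
      using uv A B by (meson mem_faces_0_iff subsetD)
    then show "u = u' \<and> v = v'" using eq uv disj by (auto simp: doubleton_eq_iff)
  qed
  ultimately show ?thesis
    by (simp add: set_weight_def ordered_set_weight_def sum.reindex case_prod_unfold)
qed

end

theorem theorem3p3:
  fixes r :: nat
    and X :: "'a set set"
    and V :: "nat \<Rightarrow> 'a set"
    and w :: "'a set \<Rightarrow> real"
    and lam :: real
    and A B :: "'a set set"
    and \<alpha> \<beta> :: real
    and \<alpha>p \<beta>p :: "nat \<Rightarrow> real"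
  assumes "r \<ge> 1"
    and "weighted_partite_complex X r V w"
    and "partite_expander r X V w (- lam) lam"
    and "A \<subseteq> faces_of_dim X 0"
    and "B \<subseteq> faces_of_dim X 0"
    and "\<alpha> = set_weight w A"
    and "\<beta> = set_weight w B"
    and "\<And>i. i \<in> {0..r} \<Longrightarrow> \<alpha>p i = set_weight w (A \<inter> part_faces X V i)"
    and "\<And>i. i \<in> {0..r} \<Longrightarrow> \<beta>p i = set_weight w (B \<inter> part_faces X V i)"
  shows "(\<forall>T S. T \<subseteq> {0..r} \<and> S \<subseteq> {0..r} \<and>
            A \<subseteq> (\<Union>i\<in>T. part_faces X V i) \<and> B \<subseteq> (\<Union>j\<in>S. part_faces X V j) \<and> S \<inter> T = {} \<longrightarrow>
            \<bar>1/2 * set_weight w (edges_between X A B) - (real r + 1) / real r * (\<alpha> * \<beta>)\<bar>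
              \<le> lam * (real r + 1) *
                 sqrt (\<alpha> * \<beta> * (real (card T) / (real r + 1) - \<alpha>)
                             * (real (card S) / (real r + 1) - \<beta>)))
       \<and> \<bar>1/2 * ordered_set_weight w (ordered_edges_between X A B)
            - (real r + 1) / real r * (\<alpha> * \<beta> - (\<Sum>i=0..r. \<alpha>p i * \<beta>p i))\<bar>
              \<le> lam * real r * sqrt (\<alpha> * \<beta> * (1 - \<alpha>) * (1 - \<beta>))
       \<and> 1/2 * ordered_set_weight w (ordered_edges_between X A B)
              \<le> (real r + 1) / real r * (\<alpha> * \<beta> - (\<Sum>i=0..r. \<alpha>p i * \<beta>p i))
                 + lam * real r * sqrt (\<alpha> * \<beta> * (1 - \<alpha>) * (1 - \<beta>))
       \<and> (real r + 1) / real r * (\<alpha> * \<beta> - (\<Sum>i=0..r. \<alpha>p i * \<beta>p i))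
                 + lam * real r * sqrt (\<alpha> * \<beta> * (1 - \<alpha>) * (1 - \<beta>))
              \<le> (real r + 1) / real r * (\<alpha> * \<beta>)
                 + lam * real r * sqrt (\<alpha> * \<beta> * (1 - \<alpha>) * (1 - \<beta>))"
proof -
  interpret weighted_partite_complex X r V w by fact
  note r = assms(1) and ex = assms(3) and A = assms(4) and B = assms(5)
  have lam: "0 \<le> lam" using ex by (simp add: partite_expander_def)
  define Va where "Va = \<alpha> - (real r + 1) * (\<Sum>i=0..r. (set_weight w (A \<inter> P i))\<^sup>2)"
  define Vb where "Vb = \<beta> - (real r + 1) * (\<Sum>i=0..r. (set_weight w (B \<inter> P i))\<^sup>2)"
  have Va: "0 \<le> Va" and Vb: "0 \<le> Vb"
    unfolding Va_def Vb_def assms(6,7) by (intro centred_norm_nonneg r A B)+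
  have ab: "(\<Sum>i=0..r. \<alpha>p i * \<beta>p i) = (\<Sum>i=0..r. set_weight w (A \<inter> P i) * set_weight w (B \<inter> P i))"
    using assms(8,9) by (intro sum.cong) auto
  have mixing: "\<bar>1/2 * ordered_set_weight w (ordered_edges_between X A B)
      - (real r + 1) / real r * (\<alpha> * \<beta> - (\<Sum>i=0..r. \<alpha>p i * \<beta>p i))\<bar> \<le> lam * (sqrt Va * sqrt Vb)"
    using mixing_centred[OF r ex A B] unfolding ab Va_def Vb_def assms(6,7) by (simp only: mult.assoc)
  have sum_nonneg: "0 \<le> (\<Sum>i=0..r. \<alpha>p i * \<beta>p i)"
    unfolding ab using A B
    by (intro sum_nonneg mult_nonneg_nonneg set_weight_vertices_nonneg) auto
  have i: "\<bar>1/2 * set_weight w (edges_between X A B) - (real r + 1) / real r * (\<alpha> * \<beta>)\<bar>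
      \<le> lam * (real r + 1) * sqrt (\<alpha> * \<beta> * (real (card T) / (real r + 1) - \<alpha>)
          * (real (card S) / (real r + 1) - \<beta>))"
    if T: "T \<subseteq> {0..r}" and S: "S \<subseteq> {0..r}" and AT: "A \<subseteq> (\<Union>i\<in>T. P i)"
      and BS: "B \<subseteq> (\<Union>j\<in>S. P j)" and ST: "S \<inter> T = {}" for T S
  proof -
    \<comment> \<open>Serves \<open>A\<close> with \<open>T\<close> and \<open>B\<close> with
      \<open>S\<close>. For nonempty \<open>K\<close>, \<open>c \<le> card K * c\<close> trades the
      factor \<open>card K\<close> for the uniform constant \<open>r + 1\<close>; for empty
      \<open>K\<close> everything is 0.\<close>
    have le: "c \<le> (real r + 1) * (x * (real (card K) / (real r + 1) - x))"
      if "K \<subseteq> {0..r}" "D \<subseteq> (\<Union>i\<in>K. P i)" "x = set_weight w D" "0 \<le> c"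
        "c = x - (real r + 1) * (\<Sum>i=0..r. (set_weight w (D \<inter> P i))\<^sup>2)" for c x K D
    proof (cases "K = {}")
      case True
      then show ?thesis using that(2-5) by (simp add: set_weight_def)
    next
      case False
      then have "1 \<le> card K"
        using finite_subset[OF that(1)] by (simp add: Suc_le_eq card_gt_0_iff)
      then have "c \<le> real (card K) * c"
        using mult_right_mono[of 1 "real (card K)" c] that(4) by simp
      also have "\<dots> \<le> x * (real (card K) - (real r + 1) * x)"
        using centred_norm_bound[OF r that(1,2)] that(3,5) by simp
      also have "\<dots> = (real r + 1) * (x * (real (card K) / (real r + 1) - x))"
        by (simp add: field_simps)
      finally show ?thesis .
    qed
    have disj: "v \<notin> P i \<or> v \<notin> P j" if "i \<in> T" "j \<in> S" for v i j
      using part_faces_disjoint[of i j v] that T S ST by force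
    have "A \<inter> B = {}" using AT BS disj by blast
    \<comment> \<open>No part meets both \<open>A\<close> and \<open>B\<close>, so the diagonal
      correction disappears.\<close>
    moreover have "(\<Sum>i=0..r. \<alpha>p i * \<beta>p i) = 0"
      unfolding ab
    proof (intro sum.neutral ballI)
      fix k assume k: "k \<in> {0..r}"
      have "A \<inter> P k = {} \<or> B \<inter> P k = {}"
      proof (cases "k \<in> T")
        case True
        then show ?thesis using BS disj by blast
      next
        case False
        then have "A \<inter> P k = {}"
          using k AT T part_faces_disjoint by fastforce
        then show ?thesis ..
      qed
      then show "set_weight w (A \<inter> P k) * set_weight w (B \<inter> P k) = 0"
        by (auto simp: set_weight_def)
    qed
    ultimately have "\<bar>1/2 * set_weight w (edges_between X A B) - (real r + 1) / real r * (\<alpha> * \<beta>)\<bar>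
        \<le> lam * (sqrt Va * sqrt Vb)"
      using mixing by (simp add: set_weight_edges_between[OF A B])
    also have "\<dots> \<le> lam * ((real r + 1) * sqrt (\<alpha> * (real (card T) / (real r + 1) - \<alpha>)
        * (\<beta> * (real (card S) / (real r + 1) - \<beta>))))"
      using lam by (intro mult_left_mono sqrt_mult_sqrt_le Va Vb le[OF T AT] le[OF S BS])
        (auto simp: Va_def Vb_def assms(6,7))
    finally show ?thesis by (simp add: mult_ac)
  qed
  have ii: "\<bar>1/2 * ordered_set_weight w (ordered_edges_between X A B)
      - (real r + 1) / real r * (\<alpha> * \<beta> - (\<Sum>i=0..r. \<alpha>p i * \<beta>p i))\<bar>
      \<le> lam * real r * sqrt (\<alpha> * \<beta> * (1 - \<alpha>) * (1 - \<beta>))"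
  proof -
    \<comment> \<open>Taking all \<open>r + 1\<close> parts gives
      \<open>c \<le> x * (1 - x)\<close>. As \<open>c\<close> is nonnegative, so is the right side,
      and \<open>1 \<le> r\<close> permits the factor \<open>r\<close>.\<close>
    have le: "c \<le> real r * (x * (1 - x))"
      if "D \<subseteq> X0" "x = set_weight w D" "0 \<le> c"
        "c = x - (real r + 1) * (\<Sum>i=0..r. (set_weight w (D \<inter> P i))\<^sup>2)" for c x D
    proof -
      have "D \<subseteq> (\<Union>i\<in>{0..r}. P i)" using that(1) faces_0_eq_Union by simp
      from centred_norm_bound[OF r subset_refl this]
      have "(real r + 1) * c \<le> x * (real r + 1 - (real r + 1) * x)"
        unfolding that(2,4) by (simp add: add.commute)
      then have "(real r + 1) * c \<le> (real r + 1) * (x * (1 - x))"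
        by (simp add: algebra_simps)
      then have "c \<le> x * (1 - x)" by (simp add: mult_le_cancel_left)
      also have "\<dots> \<le> real r * (x * (1 - x))"
        using mult_right_mono[of 1 "real r" "x * (1 - x)"] r calculation that(3) by simp
      finally show ?thesis .
    qed
    have "lam * (sqrt Va * sqrt Vb) \<le> lam * (real r * sqrt (\<alpha> * (1 - \<alpha>) * (\<beta> * (1 - \<beta>))))"
      using lam by (intro mult_left_mono sqrt_mult_sqrt_le Va Vb le[OF A] le[OF B])
        (auto simp: Va_def Vb_def assms(6,7))
    then show ?thesis using mixing by (simp add: mult_ac)
  qed
  have "(real r + 1) / real r * (\<alpha> * \<beta> - (\<Sum>i=0..r. \<alpha>p i * \<beta>p i)) \<le> (real r + 1) / real r * (\<alpha> * \<beta>)"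
    using sum_nonneg by (intro mult_left_mono) auto
  with i ii show ?thesis by (auto simp: abs_le_iff)
qed

end
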